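(* Let $\mathcal{G}=(\mathcal{V},\mathcal{E})$ be a connected undirected graph on $n$ nodes, let $k>0$, and let $1\le f\le n$. Consider the Stackelberg attacker-defender game with payoff $J_2(\mathfrak{F},\mathfrak{D})$, with $f$ defense nodes and $f$ attacked nodes ($|\mathfrak{F}|=|\mathfrak{D}|=f$) and the defender as the game leader. For a set $\mathfrak{D}$ of $f$ defense nodes, denote the corresponding virtual agent by $\ell_{\mathfrak{D}}$. Then a solution of the game is when the defender chooses a set $\mathfrak{D}$ for which the maximum sum of effective resistances between $\ell_{\mathfrak{D}}$ and all combinations of $f$ nodes in the network is minimized, i.e. $$\mathfrak{D}^*\in\arg\min_{\mathfrak{D}\subseteq\mathcal{V},\,|\mathfrak{D}|=f}\ \max_{\mathfrak{F}\subseteq\mathcal{V},\,|\mathfrak{F}|=f}\ \sum_{j\in\mathfrak{F}}R_{\ell_{\mathfrak{D}}j}.$$ In this case the attacker chooses the set of $f$ attacked nodes as $$\mathfrak{F}^*\in\arg\max_{\mathfrak{F}\subseteq\mathcal{V},\,|\mathfrak{F}|=f}\ \sum_{j\in\mathfrak{F}}R_{\ell_{\mathfrak{D}^*}j}.$$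
   Context: $\mathcal{G}$ is simple and unweighted, with Laplacian matrix $L=D-A$ ($A$ the adjacency matrix, $D$ the diagonal matrix of degrees). For a nonempty set $\mathfrak{D}\subseteq\mathcal{V}$ of defense nodes, $D_y=\mathrm{diag}(y)$ with $y_i=1$ if $i\in\mathfrak{D}$ and $y_i=0$ otherwise, and $\bar L=L+kD_y$ (invertible). For a set $\mathfrak{F}\subseteq\mathcal{V}$ of $f$ attacked nodes the payoff is $$J_2(\mathfrak{F},\mathfrak{D})=\frac12 f+\frac12\sum_{i\in\mathfrak{F}}\bar L^{-1}_{ii},$$ where $\bar L^{-1}_{ii}$ is the $i$-th diagonal element of $\bar L^{-1}$. Virtual agent: given $\mathfrak{D}$, the extended graph is obtained from $\mathcal{G}$ by adding one new node $\ell_{\mathfrak{D}}$ (the virtual agent, or ground) joined to each node of $\mathfrak{D}$ by an edge of weight $k$; the edges of $\mathcal{G}$ have weight $1$. $R_{\ell_{\mathfrak{D}}j}$ is the effective resistance between $\ell_{\mathfrak{D}}$ and $j$ in the extended graph, i.e. the electrical resistance measured between these nodes when each edge is a resistor with conductance equal to its weight. Stackelberg game with the defender as leader: the defender first chooses $\mathfrak{D}$ with $|\mathfrak{D}|=f$, and the attacker, knowing $\mathfrak{D}$, chooses a best response $\mathfrak{F}\in\arg\max_{|\mathfrak{F}|=f}J_2(\mathfrak{F},\mathfrak{D})$. A solution (equilibrium) is a pair $(\mathfrak{D}^*,\mathfrak{F}^* )$ such that $\mathfrak{D}^*$ minimizes $\max_{|\mathfrak{F}|=f}J_2(\mathfrak{F},\mathfrak{D})$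 over $\mathfrak{D}$ with $|\mathfrak{D}|=f$, and $\mathfrak{F}^*$ maximizes $J_2(\mathfrak{F},\mathfrak{D}^* )$ over $\mathfrak{F}$ with $|\mathfrak{F}|=f$. *)

theory Defs imports "HOL-Analysis.Analysis" begin

text \<open>
  A simple undirected graph whose nodes are the elements of the finite type \<open>'n\<close> is given by its
  adjacency relation, a symmetric and irreflexive \<open>E :: 'n rel\<close>; thus \<open>n = CARD('n)\<close>.
\<close>

definition adjacency_matrix :: "('n::finite) rel \<Rightarrow> real ^ 'n ^ 'n" where
  "adjacency_matrix E = (\<chi> i j. if (i, j) \<in> E then 1 else 0)"

definition diag_matrix :: "('n::finite \<Rightarrow> real) \<Rightarrow> real ^ 'n ^ 'n" where
  "diag_matrix d = (\<chi> i j. if i = j then d i else 0)"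

definition degree_matrix :: "('n::finite) rel \<Rightarrow> real ^ 'n ^ 'n" where
  "degree_matrix E = diag_matrix (\<lambda>i. real (card {j. (i, j) \<in> E}))"

definition laplacian :: "('n::finite) rel \<Rightarrow> real ^ 'n ^ 'n" where
  "laplacian E = degree_matrix E - adjacency_matrix E"

definition grounded_laplacian :: "real \<Rightarrow> ('n::finite) rel \<Rightarrow> 'n set \<Rightarrow> real ^ 'n ^ 'n" where
  "grounded_laplacian k E D = laplacian E + k *\<^sub>R diag_matrix (indicator D)"

definition J2 :: "real \<Rightarrow> ('n::finite) rel \<Rightarrow> 'n set \<Rightarrow> 'n set \<Rightarrow> real" where
  "J2 k E F D =
     1 / 2 * real (card F) + 1 / 2 * (\<Sum>i\<in>F. matrix_inv (grounded_laplacian k E D) $ i $ i)"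

text \<open>
  Equilibrium of the game led by the defender (the minimizer, playing \<open>D\<close>), for a payoff
  \<open>J F D\<close> to the attacker (the maximizer, playing \<open>F\<close>).
\<close>

definition stackelberg_solution ::
    "nat \<Rightarrow> ('n::finite set \<Rightarrow> 'n set \<Rightarrow> real) \<Rightarrow> 'n set \<Rightarrow> 'n set \<Rightarrow> bool" where
  "stackelberg_solution f J D F \<longleftrightarrow>
     is_arg_min (\<lambda>D. MAX F\<in>{F. card F = f}. J F D) (\<lambda>D. card D = f) D \<and>
     is_arg_max (\<lambda>F. J F D) (\<lambda>F. card F = f) F"

text \<open>
  In a resistor network with conductances \<open>w\<close> (weight \<open>0\<close> meaning no edge), \<open>v\<close> is a potential
  realizing a unit current that enters at \<open>s\<close> and leaves at \<open>t\<close>: by Ohm's law the current from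
  \<open>x\<close> to \<open>y\<close> is \<open>w x y * (v x - v y)\<close>, and the equation is Kirchhoff's current law at \<open>x\<close>.
  The effective resistance is the resulting potential difference. It is well defined whenever
  \<open>w\<close> is symmetric and nonnegative and \<open>s\<close>, \<open>t\<close> are connected by edges of positive weight;
  the potential itself is unique only up to additive constants on components.
\<close>

definition unit_current_potential ::
    "('a::finite \<Rightarrow> 'a \<Rightarrow> real) \<Rightarrow> 'a \<Rightarrow> 'a \<Rightarrow> ('a \<Rightarrow> real) \<Rightarrow> bool" where
  "unit_current_potential w s t v \<longleftrightarrow>
     (\<forall>x. (\<Sum>y\<in>UNIV. w x y * (v x - v y)) = of_bool (x = s) - of_bool (x = t))"

definition effective_resistance :: "('a::finite \<Rightarrow> 'a \<Rightarrow> real) \<Rightarrow> 'a \<Rightarrow> 'a \<Rightarrow> real" where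
  "effective_resistance w s t = (THE r. \<exists>v. unit_current_potential w s t v \<and> r = v s - v t)"

text \<open>
  The extended graph has nodes \<open>'n option\<close>, where \<open>None\<close> is the virtual agent.
\<close>

fun extended_weight ::
    "real \<Rightarrow> 'n rel \<Rightarrow> 'n set \<Rightarrow> 'n option \<Rightarrow> 'n option \<Rightarrow> real" where
  "extended_weight k E D (Some i) (Some j) = (if (i, j) \<in> E then 1 else 0)"
| "extended_weight k E D None (Some j) = (if j \<in> D then k else 0)"
| "extended_weight k E D (Some i) None = (if i \<in> D then k else 0)"
| "extended_weight k E D None None = 0"

definition virtual_agent_resistance ::
    "real \<Rightarrow> ('n::finite) rel \<Rightarrow> 'n set \<Rightarrow> 'n \<Rightarrow> real" where
  "virtual_agent_resistance k E D j = effective_resistance (extended_weight k E D) None (Some j)"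

end

theory Submission imports Defs begin

text \<open>
  Ground the virtual agent at potential \<open>0\<close>. A potential on the extended graph is then a vector on
  the nodes of the original graph, and the net current that it drives out of the original nodes is
  its product with the grounded Laplacian (lemma \<open>grounded_laplacian_mult_eq_current\<close>). A maximum
  principle shows that no nonzero vector is in the kernel of this matrix
  (\<open>grounded_laplacian_kernel\<close>), so the unit current from the agent to a node \<open>j\<close> is driven by
  exactly one grounded potential, minus the \<open>j\<close>-th column of the inverse. The potential difference
  between the agent and \<open>j\<close> is therefore the \<open>j\<close>-th diagonal entry of the inverse
  (\<open>virtual_agent_resistance_eq\<close>).

  On the sets in play, the payoff is consequently \<open>(f + S) / 2\<close>, where \<open>S\<close> is the sum of the
  resistances of the attacked nodes. This is an increasing function of \<open>S\<close> that depends neither on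
  the attacked nor on the defended set, and such a change of payoff preserves both the best
  responses of the attacker and the optimal choices of the defender.
\<close>

lemma grounded_laplacian_mult:
  fixes p :: "real ^ 'n::finite"
  shows "(grounded_laplacian k E D *v p) $ i =
    (\<Sum>j\<in>UNIV. (if (i, j) \<in> E then 1 else 0) * (p $ i - p $ j)) + (if i \<in> D then k else 0) * p $ i"
proof -
  have degree: "real (card {j. (i, j) \<in> E}) = (\<Sum>j\<in>UNIV. if (i, j) \<in> E then 1 else 0)"
    by (simp add: sum.If_cases)
  have "(grounded_laplacian k E D *v p) $ i =
    (\<Sum>j\<in>UNIV. (if i = j then real (card {j. (i, j) \<in> E}) * p $ j else 0)
      - (if (i, j) \<in> E then 1 else 0) * p $ j
      + (if i = j then (if i \<in> D then k else 0) * p $ j else 0))"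
    unfolding matrix_vector_mult_def grounded_laplacian_def laplacian_def degree_matrix_def
      diag_matrix_def adjacency_matrix_def
    by (auto simp: algebra_simps indicator_def intro!: sum.cong)
  also have "\<dots> = real (card {j. (i, j) \<in> E}) * p $ i
      - (\<Sum>j\<in>UNIV. (if (i, j) \<in> E then 1 else 0) * p $ j) + (if i \<in> D then k else 0) * p $ i"
    by (simp add: sum.distrib sum_subtractf)
  finally show ?thesis
    by (simp add: degree right_diff_distrib sum_subtractf sum_distrib_right)
qed

lemma sum_option_UNIV:
  "(\<Sum>y\<in>UNIV. g y) = g None + (\<Sum>j\<in>UNIV. g (Some j))" for g :: "'n::finite option \<Rightarrow> real"
  by (simp add: UNIV_option_conv sum.reindex)

lemma grounded_laplacian_mult_eq_current:
  "(\<Sum>y\<in>UNIV. extended_weight k E D (Some i) y * (v (Some i) - v y)) =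
    (grounded_laplacian k E D *v (\<chi> j. v (Some j) - v None)) $ i"
  by (simp add: grounded_laplacian_mult sum_option_UNIV)

text \<open>
  Maximum principle: at a node where \<open>p\<close> attains a positive maximum all currents flow outward, so
  they can only balance if every neighbour has the same potential and the node is not joined to the
  ground. By connectedness the same then holds at every node, but some node is joined to the ground.
\<close>

lemma grounded_laplacian_kernel_nonpos:
  fixes p :: "real ^ 'n::finite"
  assumes connected: "\<forall>u v. (u, v) \<in> E\<^sup>*" and "k > 0" and "D \<noteq> {}"
    and kernel: "grounded_laplacian k E D *v p = 0"
  shows "p $ i \<le> 0"
proof (rule ccontr)
  assume "\<not> p $ i \<le> 0"
  define M where "M = (MAX j. p $ j)"
  have le_M: "p $ j \<le> M" for j
    by (simp add: M_def)
  then have "M > 0"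
    using \<open>\<not> p $ i \<le> 0\<close> by (meson less_le_trans not_le)
  have "M \<in> range (($) p)"
    unfolding M_def by (rule Max_in) auto
  then obtain x where "p $ x = M"
    by auto
  have local: "y \<notin> D \<and> (\<forall>z. (y, z) \<in> E \<longrightarrow> p $ z = M)" if "p $ y = M" for y
  proof -
    let ?c = "\<lambda>z. (if (y, z) \<in> E then 1 else 0) * (p $ y - p $ z)"
    let ?g = "(if y \<in> D then k else 0) * p $ y"
    have "sum ?c UNIV + ?g = 0"
      using grounded_laplacian_mult[of k E D p y] kernel by simp
    moreover have c: "?c z \<ge> 0" for z
      using that le_M[of z] by simp
    then have "sum ?c UNIV \<ge> 0"
      by (intro sum_nonneg) auto
    moreover have "?g \<ge> 0"
      using that \<open>M > 0\<close> \<open>k > 0\<close> by simp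
    ultimately have "sum ?c UNIV = 0" and "?g = 0"
      by linarith+
    then have "?c z = 0" for z
      using c sum_nonneg_eq_0_iff[OF finite, of UNIV ?c] by (meson UNIV_I)
    then have "p $ z = M" if "(y, z) \<in> E" for z
      using that \<open>p $ y = M\<close> by (metis eq_iff_diff_eq_0 mult_1)
    moreover have "y \<notin> D"
      using \<open>?g = 0\<close> that \<open>M > 0\<close> \<open>k > 0\<close> by auto
    ultimately show ?thesis
      by blast
  qed
  have "p $ y = M" for y
  proof -
    have "(x, y) \<in> E\<^sup>*"
      using connected by blast
    then show ?thesis
      by (induction rule: rtrancl_induct) (use \<open>p $ x = M\<close> local in auto)
  qed
  then show False
    using local \<open>D \<noteq> {}\<close> by blast
qed

lemma grounded_laplacian_kernel:
  fixes p :: "real ^ 'n::finite"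
  assumes "\<forall>u v. (u, v) \<in> E\<^sup>*" and "k > 0" and "D \<noteq> {}"
    and kernel: "grounded_laplacian k E D *v p = 0"
  shows "p = 0"
proof -
  have "grounded_laplacian k E D *v (- p) = 0"
    using kernel by (simp add: linear_neg[OF matrix_vector_mul_linear])
  then have "p $ i \<le> 0" and "(- p) $ i \<le> 0" for i
    using assms grounded_laplacian_kernel_nonpos by blast+
  then show ?thesis
    by (simp add: vec_eq_iff order_antisym)
qed

lemma invertible_grounded_laplacian:
  fixes E :: "('n::finite) rel"
  assumes "\<forall>u v. (u, v) \<in> E\<^sup>*" and "k > 0" and "D \<noteq> {}"
  shows "invertible (grounded_laplacian k E D)"
  unfolding invertible_left_inverse matrix_left_invertible_ker
  using grounded_laplacian_kernel[OF assms] by blast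

lemma extended_weight_sym:
  "sym E \<Longrightarrow> extended_weight k E D x y = extended_weight k E D y x"
  by (cases x; cases y) (auto dest: symD)

text \<open>
  Charge conservation: the current along an edge leaves one end and enters the other.
\<close>

lemma total_current_eq_0:
  fixes w :: "'a::finite \<Rightarrow> 'a \<Rightarrow> real"
  assumes "\<And>x y. w x y = w y x"
  shows "(\<Sum>x\<in>UNIV. \<Sum>y\<in>UNIV. w x y * (v x - v y)) = 0"
proof -
  let ?T = "\<Sum>x\<in>UNIV. \<Sum>y\<in>UNIV. w x y * (v x - v y)"
  have "?T = (\<Sum>y\<in>UNIV. \<Sum>x\<in>UNIV. w x y * (v x - v y))"
    by (rule sum.swap)
  also have "\<dots> = (\<Sum>y\<in>UNIV. \<Sum>x\<in>UNIV. - (w y x * (v y - v x)))"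
    by (intro sum.cong refl) (metis assms minus_diff_eq mult_minus_right)
  also have "\<dots> = - ?T"
    by (simp add: sum_negf)
  finally show ?thesis
    by simp
qed

text \<open>
  By charge conservation, Kirchhoff's law at the virtual agent follows from the law at the other
  nodes, so only the latter, a linear system for the grounded potential, remains.
\<close>

lemma unit_current_potential_iff_grounded:
  fixes E :: "('n::finite) rel"
  assumes "sym E"
  shows "unit_current_potential (extended_weight k E D) None (Some j) v \<longleftrightarrow>
    grounded_laplacian k E D *v (\<chi> i. v (Some i) - v None) = - axis j 1"
    (is "?lhs \<longleftrightarrow> ?rhs")
proof -
  define cur where "cur x = (\<Sum>y\<in>UNIV. extended_weight k E D x y * (v x - v y))" for x
  have "(\<Sum>x\<in>UNIV. cur x) = 0"
    unfolding cur_def by (rule total_current_eq_0) (rule extended_weight_sym[OF assms])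
  then have None: "cur None = - (\<Sum>i\<in>UNIV. cur (Some i))"
    by (simp add: sum_option_UNIV)
  have "?rhs \<longleftrightarrow> (\<forall>i. cur (Some i) = - of_bool (i = j))"
    by (auto simp: vec_eq_iff cur_def grounded_laplacian_mult_eq_current axis_def)
  moreover have "?lhs \<longleftrightarrow> cur None = 1 \<and> (\<forall>i. cur (Some i) = - of_bool (i = j))"
    by (simp add: unit_current_potential_def split_option_all flip: cur_def)
  moreover have "cur None = 1" if "\<forall>i. cur (Some i) = - of_bool (i = j)"
    using that by (simp add: None sum_negf of_bool_def)
  ultimately show ?thesis
    by blast
qed

lemma virtual_agent_resistance_eq:
  fixes E :: "('n::finite) rel"
  assumes "sym E" and "\<forall>u v. (u, v) \<in> E\<^sup>*" and "k > 0" and "D \<noteq> {}"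
  shows "virtual_agent_resistance k E D j = matrix_inv (grounded_laplacian k E D) $ j $ j"
proof -
  let ?A = "grounded_laplacian k E D"
  have inv: "?A ** matrix_inv ?A = mat 1" "matrix_inv ?A ** ?A = mat 1"
    using someI_ex[OF invertible_grounded_laplacian[OF assms(2-4), unfolded invertible_def]]
    unfolding matrix_inv_def by auto
  have solve: "?A *v p = - axis j 1 \<longleftrightarrow> p = - column j (matrix_inv ?A)" for p
  proof -
    have "?A *v p = q \<longleftrightarrow> p = matrix_inv ?A *v q" for q
      using inv by (metis matrix_vector_mul_assoc matrix_vector_mul_lid)
    moreover have "matrix_inv ?A *v (- axis j 1) = - column j (matrix_inv ?A)"
      by (simp add: linear_neg[OF matrix_vector_mul_linear] matrix_vector_mult_basis)
    ultimately show ?thesis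
      by metis
  qed
  note potential = unit_current_potential_iff_grounded[OF assms(1), of k D j, unfolded solve]
  show ?thesis
    unfolding virtual_agent_resistance_def effective_resistance_def potential
  proof (rule the_equality)
    let ?v = "case_option 0 (\<lambda>i. - matrix_inv ?A $ i $ j)"
    have "(\<chi> i. ?v (Some i) - ?v None) = - column j (matrix_inv ?A)"
      by (simp add: vec_eq_iff column_def)
    then show "\<exists>v. (\<chi> i. v (Some i) - v None) = - column j (matrix_inv ?A) \<and>
        matrix_inv ?A $ j $ j = v None - v (Some j)"
      by (intro exI[of _ ?v]) simp
  next
    fix r
    assume "\<exists>v. (\<chi> i. v (Some i) - v None) = - column j (matrix_inv ?A) \<and>
        r = v None - v (Some j)"
    then obtain v where v: "(\<chi> i. v (Some i) - v None) = - column j (matrix_inv ?A)"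
        and r: "r = v None - v (Some j)"
      by blast
    have "v (Some j) - v None = - matrix_inv ?A $ j $ j"
      using arg_cong[OF v, of "\<lambda>p. p $ j"] by (simp add: column_def)
    then show "r = matrix_inv ?A $ j $ j"
      using r by linarith
  qed
qed

text \<open>
  Strategic equivalence: an equilibrium depends on the payoff only through comparisons, first among
  the payoffs for a fixed \<open>D\<close> and then among their maxima, and an increasing function commutes
  with the maximum.
\<close>

lemma stackelberg_solution_strict_mono:
  fixes J S :: "'n::finite set \<Rightarrow> 'n set \<Rightarrow> real"
  assumes "strict_mono h" and "f \<le> CARD('n)"
    and J: "\<And>F D. card F = f \<Longrightarrow> card D = f \<Longrightarrow> J F D = h (S F D)"
  shows "stackelberg_solution f J D F \<longleftrightarrow> stackelberg_solution f S D F"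
proof -
  have "{F :: 'n set. card F = f} \<noteq> {}"
    using obtain_subset_with_card_n[OF \<open>f \<le> CARD('n)\<close>] by blast
  then have max: "(MAX F\<in>{F. card F = f}. J F D) = h (MAX F\<in>{F. card F = f}. S F D)"
    if "card D = f" for D
    using that strict_mono_mono[OF \<open>strict_mono h\<close>]
    by (simp add: mono_Max_commute image_image J)
  have "is_arg_min (\<lambda>D. MAX F\<in>{F. card F = f}. J F D) (\<lambda>D. card D = f) D \<longleftrightarrow>
      is_arg_min (\<lambda>D. MAX F\<in>{F. card F = f}. S F D) (\<lambda>D. card D = f) D"
    unfolding is_arg_min_def using max strict_mono_less[OF \<open>strict_mono h\<close>] by metis
  moreover have "is_arg_max (\<lambda>F. J F D) (\<lambda>F. card F = f) F \<longleftrightarrow>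
      is_arg_max (\<lambda>F. S F D) (\<lambda>F. card F = f) F" if "card D = f"
    unfolding is_arg_max_def using J that strict_mono_less[OF \<open>strict_mono h\<close>] by metis
  ultimately show ?thesis
    unfolding stackelberg_solution_def is_arg_min_def by blast
qed

theorem theorem4:
  fixes E :: "('n::finite) rel" and k :: real and f :: nat and D F :: "'n set"
  assumes "sym E" and "irrefl E"
    and connected: "\<forall>u v. (u, v) \<in> E\<^sup>*"
    and "k > 0"
    and "1 \<le> f" and "f \<le> CARD('n)"
  shows "stackelberg_solution f (J2 k E) D F \<longleftrightarrow>
    is_arg_min (\<lambda>D. MAX F\<in>{F. card F = f}. \<Sum>j\<in>F. virtual_agent_resistance k E D j)
      (\<lambda>D. card D = f) D \<and>
    is_arg_max (\<lambda>F. \<Sum>j\<in>F. virtual_agent_resistance k E D j) (\<lambda>F. card F = f) F"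
proof -
  let ?S = "\<lambda>F D. \<Sum>j\<in>F. virtual_agent_resistance k E D j"
  let ?h = "\<lambda>s. 1 / 2 * real f + 1 / 2 * s"
  have "J2 k E F D = ?h (?S F D)" if "card F = f" and "card D = f" for F D
  proof -
    have "D \<noteq> {}"
      using that \<open>1 \<le> f\<close> by auto
    then show ?thesis
      using that by (simp add: J2_def virtual_agent_resistance_eq assms)
  qed
  moreover have "strict_mono ?h"
    by (simp add: strict_mono_def)
  ultimately have "stackelberg_solution f (J2 k E) D F \<longleftrightarrow> stackelberg_solution f ?S D F"
    using \<open>f \<le> CARD('n)\<close> by (intro stackelberg_solution_strict_mono[where h = ?h])
  then show ?thesis
    by (simp add: stackelberg_solution_def)
qed

end
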